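(* (Supertropical Hamilton–Cayley) Let $R$ be a supertropical domain, $n\ge1$, and $A\in M_n(R)$. Let $f_A=|\lambda I+A|=\lambda^n+\sum_{i=1}^n\alpha_i\lambda^{n-i}\in R[\lambda]$ be the characteristic polynomial of $A$, and let $\hat f_A=\lambda^n+\sum_{i=1}^n\hat\alpha_i\lambda^{n-i}$ be a tangible characteristic polynomial of $A$, i.e. $\hat\alpha_i\in\mathcal T\cup\{\mathbb 0\}$ and $\hat\alpha_i^\nu=\alpha_i^\nu$ for each $i$. Then $A$ satisfies both $f_A$ and $\hat f_A$; that is, all entries of the matrices $$f_A(A)=A^n+\sum_{i=1}^n\alpha_iA^{n-i}\quad\text{and}\quad \hat f_A(A)=A^n+\sum_{i=1}^n\hat\alpha_iA^{n-i}$$ lie in $\mathcal G_0$ (where $A^0=I$).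
   Context: A supertropical semiring $(R,\mathcal G_0,\nu)$ is a commutative semiring $R$ with unit $\mathbb 1$ and zero $\mathbb 0$ (with $\mathbb 0 r=\mathbb 0$ for all $r$), a semiring ideal $\mathcal G_0=\mathcal G\cup\{\mathbb 0\}$ (the ghost ideal, where $\mathcal G=\mathcal G_0\setminus\{\mathbb 0\}$), and an idempotent map $\nu:R\to\mathcal G_0$, written $a^\nu=\nu(a)$, preserving addition and multiplication, given by $\nu(a)=a+a$ and equal to the identity on $\mathcal G_0$, such that $a+b=a^\nu$ if $a^\nu=b^\nu$, and $a+b\in\{a,b\}$ if $a^\nu\ne b^\nu$. $\mathcal G_0$ is totally ordered by $a^\nu\le b^\nu$ iff $a^\nu+b^\nu=b^\nu$. Tangible elements: $\mathcal T=R\setminus\mathcal G_0$. It is a supertropical domain if $\mathcal T$ is a multiplicative monoid (closed under multiplication, containing $\mathbb 1$) and $\nu|_{\mathcal T}:\mathcal T\to\mathcal G$ is onto. Tropical determinant of $B=(b_{i,j})$: $|B|=\sum_{\pi\in S_n}b_{1,\pi(1)}\cdots b_{n,\pi(n)}$. The determinant $|\lambda I+A|$ is computed by the same formula in the semiring of formal polynomials $R[\lambda]$. *)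

theory Defs
  imports "HOL-Analysis.Analysis" "HOL-Computational_Algebra.Polynomial"
begin

text \<open>The underlying semiring \<open>R\<close> is the whole type \<open>'a\<close>.  The class \<open>comm_semiring_1\<close> includes
  \<open>0 \<noteq> 1\<close>, which holds in every supertropical domain since \<open>1\<close> is tangible and \<open>0\<close> is a ghost.
  \<open>G0\<close> is the ghost ideal, including \<open>0\<close>.\<close>

locale supertropical_semiring =
  fixes G0 :: "'a::comm_semiring_1 set" and \<nu> :: "'a \<Rightarrow> 'a"
  assumes ghost_zero: "0 \<in> G0"
    and ghost_add: "a \<in> G0 \<Longrightarrow> b \<in> G0 \<Longrightarrow> a + b \<in> G0"
    and ghost_mult: "a \<in> G0 \<Longrightarrow> r * a \<in> G0"
    and nu_ghost: "\<nu> a \<in> G0"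
    and nu_idem: "\<nu> (\<nu> a) = \<nu> a"
    and nu_add: "\<nu> (a + b) = \<nu> a + \<nu> b"
    and nu_mult: "\<nu> (a * b) = \<nu> a * \<nu> b"
    and nu_eq: "\<nu> a = a + a"
    and nu_id: "a \<in> G0 \<Longrightarrow> \<nu> a = a"
    and add_same_nu: "\<nu> a = \<nu> b \<Longrightarrow> a + b = \<nu> a"
    and add_diff_nu: "\<nu> a \<noteq> \<nu> b \<Longrightarrow> a + b \<in> {a, b}"

text \<open>The total order on the ghost ideal is a consequence of the axioms, not an extra one.\<close>

lemma (in supertropical_semiring) ghost_linear_order:
  "linear_order_on G0 {(x, y). x \<in> G0 \<and> y \<in> G0 \<and> x + y = y}"
proof -
  have self: "x + x = x" if "x \<in> G0" for x
    using that nu_eq nu_id by metis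
  have tot: "x + y = y \<or> y + x = x" if "x \<in> G0" "y \<in> G0" for x y
    using add_same_nu[of x y] add_diff_nu[of x y] that
    by (metis add.commute insertE nu_id singletonD)
  show ?thesis
    unfolding order_on_defs
    by (auto simp: refl_on_def total_on_def intro!: transI antisymI self)
       (metis add.assoc, metis add.commute, use tot in blast)
qed

definition tangibles :: "'a set \<Rightarrow> 'a set" where
  "tangibles G0 = - G0"

locale supertropical_domain = supertropical_semiring +
  assumes tangible_one: "1 \<in> tangibles G0"
    and tangible_mult: "a \<in> tangibles G0 \<Longrightarrow> b \<in> tangibles G0 \<Longrightarrow> a * b \<in> tangibles G0"
    and nu_onto: "\<nu> ` tangibles G0 = G0 - {0}"

text \<open>Matrices are indexed by an arbitrary finite (nonempty) type \<open>'n\<close>, so that \<open>n = CARD('n)\<close>.\<close>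

definition trop_det :: "'a::comm_semiring_1^'n^'n \<Rightarrow> 'a" where
  "trop_det B = (\<Sum>\<pi> | \<pi> permutes UNIV. \<Prod>i\<in>UNIV. B $ i $ \<pi> i)"

text \<open>\<open>[:0, 1:]\<close> is the indeterminate \<open>\<lambda>\<close>.\<close>

definition trop_charpoly :: "'a::comm_semiring_1^'n^'n \<Rightarrow> 'a poly" where
  "trop_charpoly A = trop_det (mat [:0, 1:] + map_matrix (\<lambda>a. [:a:]) A)"

text \<open>The library's \<open>*\<close>, \<open>1\<close> and \<open>^\<close> on \<open>'a^'n^'n\<close> are entrywise, hence the matrix power below.\<close>

primrec mat_pow :: "'a::comm_semiring_1^'n^'n \<Rightarrow> nat \<Rightarrow> 'a^'n^'n" where
  "mat_pow A 0 = mat 1"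
| "mat_pow A (Suc k) = A ** mat_pow A k"

definition mat_smult :: "'a::comm_semiring_1 \<Rightarrow> 'a^'n^'n \<Rightarrow> 'a^'n^'n" where
  "mat_smult c A = map_matrix (\<lambda>a. c * a) A"

definition poly_mat :: "'a::comm_semiring_1 poly \<Rightarrow> 'a^'n^'n \<Rightarrow> 'a^'n^'n" where
  "poly_mat p A = (\<Sum>i\<le>degree p. mat_smult (coeff p i) (mat_pow A i))"

definition satisfies_poly :: "'a::comm_semiring_1 set \<Rightarrow> 'a^'n^'n \<Rightarrow> 'a poly \<Rightarrow> bool" where
  "satisfies_poly G0 A p \<longleftrightarrow> (\<forall>i j. poly_mat p A $ i $ j \<in> G0)"

definition monic_poly :: "nat \<Rightarrow> (nat \<Rightarrow> 'a) \<Rightarrow> 'a::comm_semiring_1 poly" where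
  "monic_poly n \<alpha> = monom 1 n + (\<Sum>i=1..n. monom (\<alpha> i) (n - i))"

lemma coeff_monic_poly:
  "coeff (monic_poly n \<alpha>) k = (if k = n then 1 else if k < n then \<alpha> (n - k) else 0)"
proof -
  have "(\<Sum>i=1..n. coeff (monom (\<alpha> i) (n - i)) k)
      = (\<Sum>i=1..n. if i = n - k then (if k < n then \<alpha> i else 0) else 0)"
    by (intro sum.cong) auto
  also have "\<dots> = (if k < n then \<alpha> (n - k) else 0)"
    by (subst sum.delta) auto
  finally show ?thesis
    unfolding monic_poly_def coeff_add coeff_sum by auto
qed

lemma degree_monic_poly: "degree (monic_poly n \<alpha>) = n"
  by (intro antisym degree_le le_degree) (auto simp: coeff_monic_poly)

lemma poly_mat_monic_poly:
  "poly_mat (monic_poly n \<alpha>) A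
     = mat_pow A n + (\<Sum>i=1..n. mat_smult (\<alpha> i) (mat_pow A (n - i)))"
proof -
  have one: "mat_smult 1 B = B" for B :: "'a^'n^'n"
    by (simp add: mat_smult_def map_matrix_def vec_eq_iff)
  have "poly_mat (monic_poly n \<alpha>) A
      = mat_pow A n + (\<Sum>k<n. mat_smult (\<alpha> (n - k)) (mat_pow A k))"
    by (simp add: poly_mat_def degree_monic_poly coeff_monic_poly one add.commute
        lessThan_Suc_atMost[symmetric])
  also have "(\<Sum>k<n. mat_smult (\<alpha> (n - k)) (mat_pow A k))
      = (\<Sum>i=1..n. mat_smult (\<alpha> i) (mat_pow A (n - i)))"
    by (rule sum.reindex_bij_witness[of _ "\<lambda>i. n - i" "\<lambda>k. n - k"]) auto
  finally show ?thesis .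
qed

end

theory Submission
  imports Defs "HOL-Combinatorics.Cycles"
begin

text \<open>Expand both ingredients of \<open>f\<^sub>A(A)\<close> combinatorially.  The coefficient of \<open>\<lambda>\<^sup>k\<close> in \<open>f\<^sub>A\<close> is the
  sum of the weights of all permutations \<open>\<pi>\<close> of vertex sets \<open>S\<close> of size \<open>n - k\<close>, and the \<open>(i, j)\<close> entry
  of \<open>A\<^sup>k\<close> is the sum of the weights of all walks with \<open>k\<close> steps from \<open>i\<close> to \<open>j\<close>.  So entry \<open>(i, j)\<close> of
  \<open>f\<^sub>A(A)\<close> sums the weights of all triples of \<open>S\<close>, \<open>\<pi>\<close> and a walk that together have \<open>n\<close> edges.

  In Straubing's proof of the classical Cayley--Hamilton theorem such triples are paired off by
  moving one cycle between \<open>\<pi>\<close> and the walk.  A walk with \<open>k\<close> steps lists \<open>k + 1\<close> vertices and \<open>S\<close>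
  has \<open>n - k\<close> elements, so either the walk meets \<open>S\<close>, and the cycle of \<open>\<pi>\<close> through the meeting point
  can be spliced into the walk, or the walk repeats a vertex, and one of its simple cycles can be
  given to \<open>\<pi>\<close>.  The weight is unchanged, but \<open>k\<close> changes; this is \<open>cycle_exchange\<close>.

  In a supertropical semiring ghosts take over the role of signs and cancellation.  Up to \<open>\<nu>\<close> a
  sum equals its largest term.  Choose \<open>k\<close> such that the \<open>\<nu>\<close>-value of the \<open>(i, j)\<close> entry of
  \<open>\<alpha>\<^sub>n\<^sub>-\<^sub>k A\<^sup>k\<close>, with \<open>\<alpha>\<^sub>0 = 1\<close>, is maximal.  Unless it is \<open>0\<close>, it is the \<open>\<nu>\<close>-value of one triple, whose
  partner shows that a different \<open>k\<close> attains the same maximum.  A sum whose maximum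
  is attained twice is a ghost (\<open>sum_ghost_if_max_twice\<close>).  Since only the \<open>\<nu>\<close>-values of the coefficients
  enter, the argument covers \<open>f\<^sub>A\<close> and its tangible versions at the same time
  (\<open>satisfies_poly_if_nu_eq_charpoly\<close>).\<close>

section \<open>Moving cycles between walks and permutations\<close>

definition walk_weight :: "'a::comm_semiring_1^'n^'n \<Rightarrow> 'n list \<Rightarrow> 'a" where
  "walk_weight A xs = prod_list (map (\<lambda>(u, v). A $ u $ v) (zip xs (tl xs)))"

definition perm_weight :: "'a::comm_semiring_1^'n^'n \<Rightarrow> 'n set \<Rightarrow> ('n \<Rightarrow> 'n) \<Rightarrow> 'a" where
  "perm_weight A S \<pi> = (\<Prod>i\<in>S. A $ i $ \<pi> i)"

lemma walk_weight_singleton [simp]: "walk_weight A [v] = 1"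
  by (simp add: walk_weight_def)

lemma walk_weight_Cons [simp]: "walk_weight A (u # v # xs) = A $ u $ v * walk_weight A (v # xs)"
  by (simp add: walk_weight_def)

lemma walk_weight_append:
  "walk_weight A (xs @ v # ys) = walk_weight A (xs @ [v]) * walk_weight A (v # ys)"
proof (induction xs)
  case (Cons x xs)
  then show ?case
    by (cases xs) (simp_all add: mult.assoc)
qed simp

lemma walk_weight_splice:
  "walk_weight A (xs @ v # cs @ v # ys) = walk_weight A (xs @ v # ys) * walk_weight A (v # cs @ [v])"
  using walk_weight_append[of A xs v "cs @ v # ys"] walk_weight_append[of A "v # cs" v ys]
    walk_weight_append[of A xs v ys]
  by (simp add: mult_ac)

text \<open>The edges of the closed walk along a cycle are the pairs obtained by zipping the cycle with
  its own rotation.\<close>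

lemma perm_weight_cycle:
  assumes "distinct (v # cs)"
  shows "perm_weight A (set (v # cs)) (cycle_of_list (v # cs)) = walk_weight A (v # cs @ [v])"
proof -
  let ?c = "cycle_of_list (v # cs)"
  have rot: "map ?c (v # cs) = cs @ [v]"
    using cyclic_rotation[OF assms, of 1] by simp
  have "zip (v # cs @ [v]) (cs @ [v]) = zip (v # cs) (cs @ [v])"
    using zip_append1[of "v # cs" "[v]" "cs @ [v]"] by simp
  also have "\<dots> = map (\<lambda>x. (x, ?c x)) (v # cs)"
    unfolding rot[symmetric] zip_map2 zip_same_conv_map by simp
  finally have "walk_weight A (v # cs @ [v]) = prod_list (map (\<lambda>x. A $ x $ ?c x) (v # cs))"
    unfolding walk_weight_def list.sel by (simp add: o_def del: cycle_of_list.simps)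
  also have "\<dots> = perm_weight A (set (v # cs)) ?c"
    unfolding perm_weight_def by (rule prod.distinct_set_conv_list[OF assms, symmetric])
  finally show ?thesis by simp
qed

lemma ex_simple_cycle_if_not_distinct:
  assumes "\<not> distinct xs"
  shows "\<exists>as v cs bs. xs = as @ v # cs @ v # bs \<and> distinct (v # cs)"
  using assms
proof (induction xs)
  case (Cons x xs)
  show ?case
  proof (cases "distinct xs")
    case True
    with Cons.prems have "x \<in> set xs" by simp
    then obtain cs bs where "xs = cs @ x # bs" "x \<notin> set cs"
      by (meson split_list_first)
    with True have "x # xs = [] @ x # cs @ x # bs" "distinct (x # cs)" by auto
    then show ?thesis by blast
  next
    case False
    then obtain as v cs bs where "xs = as @ v # cs @ v # bs" "distinct (v # cs)"
      using Cons.IH by blast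
    then have "x # xs = (x # as) @ v # cs @ v # bs" "distinct (v # cs)" by simp_all
    then show ?thesis by blast
  qed
qed simp

lemma perm_weight_union:
  fixes S T :: "'n::finite set"
  assumes "S \<inter> T = {}" "\<And>x. x \<in> S \<Longrightarrow> \<rho> x = \<pi> x" "\<And>x. x \<in> T \<Longrightarrow> \<rho> x = \<sigma> x"
  shows "perm_weight A (S \<union> T) \<rho> = perm_weight A S \<pi> * perm_weight A T \<sigma>"
  using assms by (simp add: perm_weight_def prod.union_disjoint)

text \<open>Counting vertices shows that a walk avoiding \<open>S\<close> is too long to be injective, so a cycle can be
  moved in one of the two directions.  Its edges contribute the same factor to either weight
  (\<open>perm_weight_cycle\<close>).\<close>

lemma cycle_exchange:
  fixes A :: "'a::comm_semiring_1^'n^'n"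
  assumes \<pi>: "\<pi> permutes S" and xs: "xs \<noteq> []" and size: "length xs + card S = Suc CARD('n)"
  obtains S' \<pi>' xs' where "\<pi>' permutes S'" "xs' \<noteq> []" "hd xs' = hd xs" "last xs' = last xs"
    "length xs' + card S' = Suc CARD('n)" "length xs' \<noteq> length xs"
    "perm_weight A S' \<pi>' * walk_weight A xs' = perm_weight A S \<pi> * walk_weight A xs"
proof (cases "set xs \<inter> S = {}")
  case True
  have "card (set xs) + card S \<le> CARD('n)"
    by (metis True card_Un_disjoint card_mono finite subset_UNIV)
  with size have "\<not> distinct xs"
    using distinct_card[of xs] by auto
  then obtain as v cs bs where dec: "xs = as @ v # cs @ v # bs" and dist: "distinct (v # cs)"
    using ex_simple_cycle_if_not_distinct by blast
  let ?C = "set (v # cs)" and ?c = "cycle_of_list (v # cs)"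
  have disj: "S \<inter> ?C = {}"
    using True dec by auto
  have c: "?c permutes ?C"
    by (rule cycle_permutes)
  show ?thesis
  proof (rule that[of "?c \<circ> \<pi>" "S \<union> ?C" "as @ v # bs"])
    show "?c \<circ> \<pi> permutes S \<union> ?C"
      by (intro permutes_compose permutes_subset[OF \<pi>] permutes_subset[OF c]) auto
    show "length (as @ v # bs) + card (S \<union> ?C) = Suc CARD('n)"
      using size dec disj dist distinct_card[OF dist] by (simp add: card_Un_disjoint)
    have "perm_weight A (S \<union> ?C) (?c \<circ> \<pi>) = perm_weight A S \<pi> * perm_weight A ?C ?c"
    proof (rule perm_weight_union[OF disj])
      show "(?c \<circ> \<pi>) x = \<pi> x" if "x \<in> S" for x
        using that permutes_in_image[OF \<pi>] permutes_not_in[OF c] disj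
        by (metis comp_apply disjoint_iff)
      show "(?c \<circ> \<pi>) x = ?c x" if "x \<in> ?C" for x
        using that permutes_not_in[OF \<pi>] disj by (metis comp_apply disjoint_iff)
    qed
    then show "perm_weight A (S \<union> ?C) (?c \<circ> \<pi>) * walk_weight A (as @ v # bs)
        = perm_weight A S \<pi> * walk_weight A xs"
      unfolding dec walk_weight_splice perm_weight_cycle[OF dist] by (simp add: mult_ac)
    show "hd (as @ v # bs) = hd xs"
      by (cases as) (simp_all add: dec)
  qed (simp_all add: dec)
next
  case False
  then obtain v where v: "v \<in> set xs" "v \<in> S" by blast
  then obtain as bs where dec: "xs = as @ v # bs"
    by (meson split_list)
  have perm: "permutation \<pi>"
    using \<pi> finite permutation_permutes by blast
  let ?C = "set (support \<pi> v)" and ?c = "cycle_of_list (support \<pi> v)"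
  let ?\<pi>' = "\<lambda>y. if y \<in> S - ?C then \<pi> y else y"
  \<comment> \<open>The orbit list starts at \<open>v\<close>, so that inserting it after \<open>as\<close> gives a walk.\<close>
  obtain cs where cs: "support \<pi> v = v # cs"
    using least_power_of_permutation(2)[OF perm, of v] by (simp add: upt_conv_Cons)
  have dist: "distinct (v # cs)"
    using cycle_of_permutation[OF perm, of v] unfolding cs .
  have "?C \<subseteq> S"
    using permutes_in_image[OF permutes_funpow[OF \<pi>]] v(2) by auto
  then have S: "S = (S - ?C) \<union> ?C" by blast
  have card: "card S = card (S - ?C) + length (v # cs)"
    using card_Un_disjoint[of "S - ?C" ?C] S distinct_card[OF dist] unfolding cs by auto
  show ?thesis
  proof (rule that[of ?\<pi>' "S - ?C" "as @ v # cs @ v # bs"])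
    show "?\<pi>' permutes S - ?C"
      by (rule semidecomposition[OF \<pi>]) simp
    show "length (as @ v # cs @ v # bs) + card (S - ?C) = Suc CARD('n)"
      using size dec card by simp
    have "perm_weight A ((S - ?C) \<union> ?C) \<pi> = perm_weight A (S - ?C) ?\<pi>' * perm_weight A ?C ?c"
      using cycle_restrict[OF perm, of _ v] by (intro perm_weight_union) auto
    also have "perm_weight A ?C ?c = walk_weight A (v # cs @ [v])"
      unfolding cs by (rule perm_weight_cycle[OF dist])
    finally have "perm_weight A S \<pi> = perm_weight A (S - ?C) ?\<pi>' * walk_weight A (v # cs @ [v])"
      unfolding S[symmetric] .
    then show "perm_weight A (S - ?C) ?\<pi>' * walk_weight A (as @ v # cs @ v # bs)
        = perm_weight A S \<pi> * walk_weight A xs"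
      unfolding dec walk_weight_splice by (simp only: mult_ac)
    show "hd (as @ v # cs @ v # bs) = hd xs"
      by (cases as) (simp_all add: dec)
  qed (simp_all add: dec)
qed

section \<open>Coefficients of the characteristic polynomial\<close>

definition partial_perms :: "nat \<Rightarrow> ('n::finite set \<times> ('n \<Rightarrow> 'n)) set" where
  "partial_perms m = {(S, \<pi>). card S = m \<and> \<pi> permutes S}"

lemma prod_const_poly: "(\<Prod>i\<in>S. [:f i:]) = [:\<Prod>i\<in>S. f i:]"
  by (induction S rule: infinite_finite_induct) (simp_all add: one_pCons, simp add: mult.commute)

text \<open>In the factor \<open>\<lambda>[\<pi> i = i] + A\<^sub>i\<^sub>\<pi>\<^sub>i\<close> belonging to \<open>i\<close>, choosing \<open>\<lambda>\<close> is possible only at fixed points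
  of \<open>\<pi>\<close>; so the set where \<open>\<lambda>\<close> is not chosen is a set that \<open>\<pi>\<close> permutes.\<close>

lemma trop_charpoly_expansion:
  fixes A :: "'a::comm_semiring_1^'n^'n"
  shows "trop_charpoly A = (\<Sum>S\<in>UNIV. \<Sum>\<pi> | \<pi> permutes S. monom (perm_weight A S \<pi>) (card (- S)))"
proof -
  let ?X = "\<lambda>\<pi> i. if i = \<pi> i then [:0, 1:] else 0 :: 'a poly"
  have X: "(\<Prod>i\<in>- S. ?X \<pi> i) = (if \<pi> permutes S then monom 1 (card (- S)) else 0)"
    if \<pi>: "\<pi> permutes UNIV" for S and \<pi> :: "'n \<Rightarrow> 'n"
  proof (cases "\<forall>i\<in>- S. \<pi> i = i")
    case True
    then have "\<pi> permutes S"
      using permutes_superset[OF \<pi>, of S] by auto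
    moreover have "(\<Prod>i\<in>- S. ?X \<pi> i) = (\<Prod>i\<in>- S. [:0, 1:])"
      using True by (intro prod.cong) auto
    ultimately show ?thesis
      by (simp add: monom_altdef)
  next
    case False
    then obtain i where i: "i \<notin> S" "\<pi> i \<noteq> i" by auto
    then have "\<not> \<pi> permutes S"
      by (metis permutes_not_in)
    moreover have "(\<Prod>i\<in>- S. ?X \<pi> i) = 0"
      using i by (intro prod_zero bexI[of _ i]) auto
    ultimately show ?thesis by simp
  qed
  have "trop_charpoly A = (\<Sum>\<pi> | \<pi> permutes UNIV. \<Prod>i\<in>UNIV. [:A $ i $ \<pi> i:] + ?X \<pi> i)"
    by (simp add: trop_charpoly_def trop_det_def mat_def add.commute)
  also have "\<dots> = (\<Sum>\<pi> | \<pi> permutes UNIV. \<Sum>S\<in>UNIV. [:perm_weight A S \<pi>:] * (\<Prod>i\<in>- S. ?X \<pi> i))"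
    by (simp add: prod_add prod_const_poly perm_weight_def Compl_eq_Diff_UNIV del: mult_pCons_left)
  also have "\<dots> = (\<Sum>S\<in>UNIV. \<Sum>\<pi> | \<pi> permutes UNIV.
      if \<pi> permutes S then monom (perm_weight A S \<pi>) (card (- S)) else 0)"
    by (subst sum.swap) (auto simp: X smult_monom intro!: sum.cong)
  also have "\<dots> = (\<Sum>S\<in>UNIV. \<Sum>\<pi> | \<pi> permutes S. monom (perm_weight A S \<pi>) (card (- S)))"
    by (intro sum.cong refl sum.mono_neutral_cong_right)
       (auto intro: permutes_subset)
  finally show ?thesis .
qed

lemma coeff_trop_charpoly:
  fixes A :: "'a::comm_semiring_1^'n^'n"
  assumes "k \<le> CARD('n)"
  shows "coeff (trop_charpoly A) k
    = (\<Sum>(S, \<pi>)\<in>partial_perms (CARD('n) - k). perm_weight A S \<pi>)"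
proof -
  have k: "card (- S) = k \<longleftrightarrow> card S = CARD('n) - k" for S :: "'n set"
    using assms card_mono[of UNIV S] card_Diff_subset[of S UNIV] by (auto simp: Compl_eq_Diff_UNIV)
  have "coeff (trop_charpoly A) k
      = (\<Sum>S\<in>UNIV. if card S = CARD('n) - k then \<Sum>\<pi> | \<pi> permutes S. perm_weight A S \<pi> else 0)"
    unfolding trop_charpoly_expansion coeff_sum coeff_monom k by (intro sum.cong) auto
  also have "\<dots> = (\<Sum>S | card S = CARD('n) - k. \<Sum>\<pi> | \<pi> permutes S. perm_weight A S \<pi>)"
    by (simp add: sum.If_cases)
  also have "\<dots> = (\<Sum>(S, \<pi>)\<in>partial_perms (CARD('n) - k). perm_weight A S \<pi>)"
    by (subst sum.Sigma) (auto simp: partial_perms_def intro!: sum.cong)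
  finally show ?thesis .
qed

lemma coeff_trop_charpoly_CARD: "coeff (trop_charpoly (A :: 'a::comm_semiring_1^'n^'n)) CARD('n) = 1"
proof -
  have "partial_perms 0 = {({} :: 'n set, id)}"
    by (auto simp: partial_perms_def)
  then show ?thesis
    by (simp add: coeff_trop_charpoly perm_weight_def)
qed

lemma coeff_trop_charpoly_eq_0:
  fixes A :: "'a::comm_semiring_1^'n^'n"
  assumes "k > CARD('n)"
  shows "coeff (trop_charpoly A) k = 0"
proof -
  have "card (- S) \<noteq> k" for S :: "'n set"
    using assms card_mono[of UNIV "- S"] by auto
  then show ?thesis
    by (simp add: trop_charpoly_expansion coeff_sum)
qed

lemma trop_charpoly_eq_monic_poly:
  fixes A :: "'a::comm_semiring_1^'n^'n"
  assumes "\<And>i. i \<in> {1..CARD('n)} \<Longrightarrow> \<alpha> i = coeff (trop_charpoly A) (CARD('n) - i)"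
  shows "trop_charpoly A = monic_poly CARD('n) \<alpha>"
proof (rule poly_eqI)
  fix k
  consider "k < CARD('n)" | "k = CARD('n)" | "k > CARD('n)"
    by linarith
  then show "coeff (trop_charpoly A) k = coeff (monic_poly CARD('n) \<alpha>) k"
  proof cases
    case 1
    then have "\<alpha> (CARD('n) - k) = coeff (trop_charpoly A) k"
      by (subst assms) auto
    with 1 show ?thesis
      by (simp add: coeff_monic_poly)
  qed (simp_all add: coeff_monic_poly coeff_trop_charpoly_CARD coeff_trop_charpoly_eq_0)
qed

section \<open>Sums in a supertropical semiring\<close>

context supertropical_semiring
begin

definition nu_le :: "'a \<Rightarrow> 'a \<Rightarrow> bool" where
  "nu_le a b \<longleftrightarrow> \<nu> a + \<nu> b = \<nu> b"

lemma nu_0: "\<nu> 0 = 0"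
  using nu_id ghost_zero by blast

lemma nu_add_self: "\<nu> a + \<nu> a = \<nu> a"
  using nu_eq nu_idem by metis

lemma nu_le_antisym: "nu_le a b \<Longrightarrow> nu_le b a \<Longrightarrow> \<nu> a = \<nu> b"
  by (simp add: nu_le_def add.commute)

lemma nu_le_trans: "nu_le a b \<Longrightarrow> nu_le b c \<Longrightarrow> nu_le a c"
  by (metis nu_le_def add.assoc)

lemma nu_le_linear: "nu_le a b \<or> nu_le b a"
  using add_diff_nu[of "\<nu> a" "\<nu> b"] unfolding nu_le_def
  by (metis add.commute insertE nu_add_self nu_idem singletonD)

lemma nu_le_mult: "nu_le a b \<Longrightarrow> nu_le c d \<Longrightarrow> nu_le (a * c) (b * d)"
proof -
  assume "nu_le a b" "nu_le c d"
  then have "nu_le (a * c) (b * c)" "nu_le (b * c) (b * d)"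
    by (simp_all add: nu_le_def nu_mult flip: distrib_left distrib_right)
  then show ?thesis by (rule nu_le_trans)
qed

lemma nu_le_0: "nu_le 0 a"
  by (simp add: nu_le_def nu_0)

lemma nu_le_sum:
  assumes "finite I" "i \<in> I"
  shows "nu_le (f i) (sum f I)"
  unfolding nu_le_def sum.remove[OF assms, of f] nu_add by (simp add: nu_add_self flip: add.assoc)

text \<open>Since the \<open>\<nu>\<close>-values are totally ordered, with addition as maximum, the \<open>\<nu>\<close>-value of a sum is
  that of one of its terms; only the empty sum needs the alternative \<open>0\<close>.\<close>

lemma nu_sum_attained:
  assumes "finite I"
  shows "\<nu> (sum f I) = 0 \<or> (\<exists>i\<in>I. \<nu> (sum f I) = \<nu> (f i))"
  using assms
proof (induction I)
  case (insert i I)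
  have "\<nu> (f i + sum f I) = \<nu> (f i) \<or> \<nu> (f i + sum f I) = \<nu> (sum f I)"
    using nu_le_linear[of "f i" "sum f I"] by (auto simp: nu_le_def nu_add add.commute)
  with insert show ?case by auto
qed (simp add: nu_0)

lemma sum_nu_le:
  assumes "finite I" "\<And>i. i \<in> I \<Longrightarrow> nu_le (f i) a"
  shows "nu_le (sum f I) a"
  using assms
proof (induction I)
  case (insert i I)
  then have "\<nu> (f i) + \<nu> a = \<nu> a" "\<nu> (sum f I) + \<nu> a = \<nu> a"
    by (simp_all add: nu_le_def)
  with insert.hyps show ?case
    by (simp add: nu_le_def nu_add add.assoc)
qed (simp add: nu_le_0)

text \<open>If the \<open>\<nu>\<close>-values agree, the sum is a ghost whatever \<open>b\<close> is; otherwise the larger summand \<open>a\<close>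
  absorbs \<open>b\<close>.\<close>

lemma ghost_add_dominated:
  assumes "a \<in> G0" "nu_le b a"
  shows "a + b \<in> G0"
proof (cases "\<nu> a = \<nu> b")
  case True
  then show ?thesis
    using add_same_nu nu_ghost by metis
next
  case False
  have "\<nu> (a + b) = \<nu> a"
    using assms(2) by (simp add: nu_le_def nu_add add.commute)
  with False have "a + b = a"
    using add_diff_nu[OF False] by auto
  then show ?thesis
    using assms(1) by simp
qed

text \<open>Two maximal terms already add up to the ghost \<open>\<nu> (f k)\<close>, which dominates all the others.\<close>

lemma sum_ghost_if_max_twice:
  assumes "finite I" "k \<in> I" "l \<in> I" "k \<noteq> l" "\<nu> (f k) = \<nu> (f l)"
    and max: "\<And>i. i \<in> I \<Longrightarrow> nu_le (f i) (f k)"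
  shows "sum f I \<in> G0"
proof -
  have "sum f I = f k + f l + sum f (I - {k} - {l})"
    using assms sum.remove[of I k f] sum.remove[of "I - {k}" l f] by (simp add: add.assoc)
  also have "f k + f l = \<nu> (f k)"
    by (rule add_same_nu) fact
  also have "\<nu> (f k) + sum f (I - {k} - {l}) \<in> G0"
  proof (rule ghost_add_dominated[OF nu_ghost])
    have "nu_le (sum f (I - {k} - {l})) (f k)"
      using assms(1) max by (intro sum_nu_le) auto
    then show "nu_le (sum f (I - {k} - {l})) (\<nu> (f k))"
      by (simp add: nu_le_def nu_idem)
  qed
  finally show ?thesis .
qed

lemma ex_nu_max:
  assumes "finite I" "I \<noteq> {}"
  shows "\<exists>k\<in>I. \<forall>i\<in>I. nu_le (f i) (f k)"
  using assms
proof (induction I rule: finite_ne_induct)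
  case (singleton i)
  then show ?case by (simp add: nu_le_def nu_add_self)
next
  case (insert i I)
  then show ?case
    using nu_le_linear nu_le_trans by (metis insert_iff)
qed

section \<open>Walks and matrix powers\<close>

lemma walk_nu_le_mat_pow:
  assumes "length xs = Suc k"
  shows "nu_le (walk_weight A xs) (mat_pow A k $ hd xs $ last xs)"
  using assms
proof (induction k arbitrary: xs)
  case 0
  then obtain v where "xs = [v]"
    by (metis length_0_conv length_Suc_conv)
  then show ?case
    by (simp add: mat_def nu_le_def nu_add_self)
next
  case (Suc k)
  then obtain u v ys where xs: "xs = u # v # ys"
    by (metis length_Suc_conv)
  let ?t = "\<lambda>w. A $ u $ w * mat_pow A k $ w $ last xs"
  have "nu_le (walk_weight A (v # ys)) (mat_pow A k $ v $ last xs)"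
    using Suc.IH[of "v # ys"] Suc.prems by (simp add: xs)
  then have "nu_le (walk_weight A xs) (?t v)"
    unfolding xs walk_weight_Cons by (intro nu_le_mult) (simp add: nu_le_def nu_add_self)
  moreover have "nu_le (?t v) (sum ?t UNIV)"
    by (rule nu_le_sum) simp_all
  ultimately have "nu_le (walk_weight A xs) (sum ?t UNIV)"
    by (rule nu_le_trans)
  then show ?case
    by (simp add: xs matrix_matrix_mult_def)
qed

text \<open>The alternative \<open>0\<close> occurs when there is no walk at all, as for \<open>k = 0\<close> and \<open>i \<noteq> j\<close>.\<close>

lemma nu_mat_pow_attained:
  "\<nu> (mat_pow A k $ i $ j) = 0 \<or> (\<exists>xs. length xs = Suc k \<and> hd xs = i \<and> last xs = j
    \<and> \<nu> (mat_pow A k $ i $ j) = \<nu> (walk_weight A xs))"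
proof (induction k arbitrary: i)
  case 0
  show ?case
  proof (cases "i = j")
    case True
    then have "length [i] = Suc 0 \<and> hd [i] = i \<and> last [i] = j
        \<and> \<nu> (mat_pow A 0 $ i $ j) = \<nu> (walk_weight A [i])"
      by (simp add: mat_def)
    then show ?thesis by blast
  qed (simp add: mat_def nu_0)
next
  case (Suc k)
  let ?t = "\<lambda>w. A $ i $ w * mat_pow A k $ w $ j"
  have pow: "mat_pow A (Suc k) $ i $ j = sum ?t UNIV"
    by (simp add: matrix_matrix_mult_def)
  consider "\<nu> (sum ?t UNIV) = 0" | w where "\<nu> (sum ?t UNIV) = \<nu> (?t w)"
    using nu_sum_attained[of UNIV ?t] by auto
  then show ?case
  proof cases
    case 1
    then show ?thesis unfolding pow by simp
  next
    case w: 2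
    from Suc.IH[of w] show ?thesis
    proof (elim disjE exE conjE)
      assume "\<nu> (mat_pow A k $ w $ j) = 0"
      then show ?thesis
        unfolding pow w by (simp add: nu_mult)
    next
      fix xs assume xs: "length xs = Suc k" "hd xs = w" "last xs = j"
        "\<nu> (mat_pow A k $ w $ j) = \<nu> (walk_weight A xs)"
      obtain ys where ys: "xs = w # ys"
        using xs(1,2) by (cases xs) auto
      have "length (i # xs) = Suc (Suc k) \<and> hd (i # xs) = i \<and> last (i # xs) = j
          \<and> \<nu> (mat_pow A (Suc k) $ i $ j) = \<nu> (walk_weight A (i # xs))"
        using xs unfolding pow w ys by (simp add: nu_mult)
      then show ?thesis by blast
    qed
  qed
qed

section \<open>The supertropical Hamilton--Cayley theorem\<close>

text \<open>The maximum over \<open>k\<close> is attained twice because a triple realising it has a partner of the same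
  weight at another \<open>k\<close>.  When the maximum is \<open>0\<close> there may be no triple, but then all terms have
  \<open>\<nu>\<close>-value \<open>0\<close>, and there are at least two of them because \<open>n > 0\<close>.\<close>

lemma satisfies_poly_if_nu_eq_charpoly:
  fixes A :: "'a^'n^'n"
  assumes deg: "degree p = CARD('n)"
    and nu_p: "\<And>k. k \<le> CARD('n) \<Longrightarrow> \<nu> (coeff p k) = \<nu> (coeff (trop_charpoly A) k)"
  shows "satisfies_poly G0 A p"
  unfolding satisfies_poly_def
proof (intro allI)
  fix i j
  let ?n = "CARD('n)"
  define F where "F k = coeff p k * mat_pow A k $ i $ j" for k
  obtain k where k: "k \<le> ?n" and max: "\<And>l. l \<le> ?n \<Longrightarrow> nu_le (F l) (F k)"
    using ex_nu_max[of "{..?n}" F] by auto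
  have "\<exists>l\<le>?n. l \<noteq> k \<and> \<nu> (F l) = \<nu> (F k)"
  proof (cases "\<nu> (F k) = 0")
    case True
    have zero: "\<nu> (F l) = 0" if "l \<le> ?n" for l
      using max[OF that] True by (simp add: nu_le_def)
    have "?n \<noteq> 0" by simp
    then obtain l where "l \<le> ?n" "l \<noteq> k"
      by (metis order.refl zero_le)
    then show ?thesis
      using zero k by metis
  next
    case False
    have nu_F: "\<nu> (F k) = \<nu> (coeff (trop_charpoly A) k) * \<nu> (mat_pow A k $ i $ j)"
      by (simp add: F_def nu_mult nu_p[OF k])
    have "\<nu> (mat_pow A k $ i $ j) \<noteq> 0" "\<nu> (coeff (trop_charpoly A) k) \<noteq> 0"
      using False nu_F by auto
    moreover have "finite (partial_perms m :: ('n set \<times> ('n \<Rightarrow> 'n)) set)" for m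
      by simp
    ultimately obtain S \<pi> xs where S: "card S = ?n - k" "\<pi> permutes S"
        "\<nu> (coeff (trop_charpoly A) k) = \<nu> (perm_weight A S \<pi>)"
      and xs: "length xs = Suc k" "hd xs = i" "last xs = j"
        "\<nu> (mat_pow A k $ i $ j) = \<nu> (walk_weight A xs)"
      using nu_sum_attained[of "partial_perms (?n - k)" "\<lambda>(S, \<pi>). perm_weight A S \<pi>"]
        nu_mat_pow_attained[of A k i j]
      unfolding coeff_trop_charpoly[OF k] by (auto simp: partial_perms_def)
    have "xs \<noteq> []" "length xs + card S = Suc ?n"
      using xs S k by auto
    then obtain S' \<pi>' xs' where \<pi>': "\<pi>' permutes S'"
      and xs': "xs' \<noteq> []" "hd xs' = hd xs" "last xs' = last xs" "length xs' \<noteq> length xs"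
      and size: "length xs' + card S' = Suc ?n"
      and weight: "perm_weight A S' \<pi>' * walk_weight A xs' = perm_weight A S \<pi> * walk_weight A xs"
      using cycle_exchange[OF S(2), of xs A] by metis
    from xs'(1) obtain l where len: "length xs' = Suc l"
      by (cases xs') auto
    with size xs'(4) xs(1) have l: "l \<le> ?n" "card S' = ?n - l" "l \<noteq> k"
      by linarith+
    have "nu_le (perm_weight A S' \<pi>') (coeff (trop_charpoly A) l)"
      using nu_le_sum[of "partial_perms (?n - l)" "(S', \<pi>')" "\<lambda>(S, \<pi>). perm_weight A S \<pi>"] \<pi>' l
      unfolding coeff_trop_charpoly[OF l(1)] by (simp add: partial_perms_def)
    moreover have "nu_le (walk_weight A xs') (mat_pow A l $ i $ j)"
      using walk_nu_le_mat_pow[OF len, of A] xs xs' by simp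
    ultimately have "nu_le (perm_weight A S \<pi> * walk_weight A xs)
        (coeff (trop_charpoly A) l * mat_pow A l $ i $ j)"
      unfolding weight[symmetric] by (rule nu_le_mult)
    then have "nu_le (F k) (F l)"
      by (simp add: nu_le_def F_def nu_mult nu_p k l S xs)
    then show ?thesis
      using nu_le_antisym[OF max] l by blast
  qed
  then obtain l where "l \<le> ?n" "l \<noteq> k" "\<nu> (F l) = \<nu> (F k)" by blast
  then have "sum F {..?n} \<in> G0"
    using k max by (intro sum_ghost_if_max_twice[of _ k l]) auto
  then show "poly_mat p A $ i $ j \<in> G0"
    by (simp add: poly_mat_def deg F_def mat_smult_def)
qed

end

theorem theorem5p2:
  fixes G0 :: "'a::comm_semiring_1 set" and \<nu> :: "'a \<Rightarrow> 'a"
    and A :: "'a^'n^'n"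
    and \<alpha> \<alpha>h :: "nat \<Rightarrow> 'a"
  assumes "supertropical_domain G0 \<nu>"
    and "\<And>i. i \<in> {1..CARD('n)} \<Longrightarrow> \<alpha> i = coeff (trop_charpoly A) (CARD('n) - i)"
    and "\<And>i. i \<in> {1..CARD('n)} \<Longrightarrow> \<alpha>h i \<in> tangibles G0 \<union> {0} \<and> \<nu> (\<alpha>h i) = \<nu> (\<alpha> i)"
  shows "trop_charpoly A = monic_poly CARD('n) \<alpha>
    \<and> satisfies_poly G0 A (trop_charpoly A)
    \<and> satisfies_poly G0 A (monic_poly CARD('n) \<alpha>h)"
proof (intro conjI)
  interpret supertropical_domain G0 \<nu> by fact
  show charpoly: "trop_charpoly A = monic_poly CARD('n) \<alpha>"
    using assms(2) by (rule trop_charpoly_eq_monic_poly)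
  show "satisfies_poly G0 A (trop_charpoly A)"
    by (rule satisfies_poly_if_nu_eq_charpoly) (simp_all add: charpoly degree_monic_poly)
  show "satisfies_poly G0 A (monic_poly CARD('n) \<alpha>h)"
    using assms(3)
    by (intro satisfies_poly_if_nu_eq_charpoly)
       (simp_all add: charpoly degree_monic_poly coeff_monic_poly)
qed

end
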